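(* Let $P_n$ be the path graph of order $n$. For every graph $G$ of minimum degree $\delta\ge 1$, $$\gamma_o(G\Box P_n)\ge \left\lceil\frac{(n-1)\gamma_o(G)}{2}\right\rceil+\left\lceil\frac{\delta}{2}\right\rceil.$$
   Context: All graphs are finite and simple. For a graph with vertex set $V$, a vertex $v$ and $S\subseteq V$, let $\delta_S(v)=|N(v)\cap S|$ and $\overline{S}=V\setminus S$. A nonempty set $S\subseteq V$ is a global offensive alliance if $\delta_S(v)\ge \delta_{\overline{S}}(v)+1$ for every $v\in\overline{S}$; $\gamma_o(G)$ is the minimum cardinality of a global offensive alliance of $G$. $G\Box H$ is the Cartesian product: vertex set $V(G)\times V(H)$, with $(a,b)\sim(c,d)$ iff ($a=c$ and $b\sim d$ in $H$) or ($a\sim c$ in $G$ and $b=d$). *)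

theory Defs
  imports Complex_Main "Graph_Theory.Pair_Digraph"
begin

text \<open>
  Finite simple graphs are rendered by the locale predicate \<^const>\<open>pair_graph\<close>
  (finite, symmetric, loop-free): an edge between \<open>u\<close> and \<open>v\<close> is the pair of arcs
  \<open>(u, v)\<close>, \<open>(v, u)\<close>.
\<close>

definition neighbours :: "'a pair_pre_digraph \<Rightarrow> 'a \<Rightarrow> 'a set" where
  "neighbours G v = {w. (v, w) \<in> parcs G}"

definition degree_in :: "'a pair_pre_digraph \<Rightarrow> 'a set \<Rightarrow> 'a \<Rightarrow> nat" where
  "degree_in G S v = card (neighbours G v \<inter> S)"

text \<open>Unspecified for the graph without vertices.\<close>
definition min_degree :: "'a pair_pre_digraph \<Rightarrow> nat" where
  "min_degree G = Min ((\<lambda>v. card (neighbours G v)) ` pverts G)"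

definition global_offensive_alliance :: "'a pair_pre_digraph \<Rightarrow> 'a set \<Rightarrow> bool" where
  "global_offensive_alliance G S \<longleftrightarrow>
     S \<noteq> {} \<and> S \<subseteq> pverts G \<and>
     (\<forall>v \<in> pverts G - S. degree_in G S v \<ge> degree_in G (pverts G - S) v + 1)"

text \<open>
  For a finite graph with at least one vertex the minimum is over a nonempty set, since the
  full vertex set is a global offensive alliance.
\<close>
definition offensive_number :: "'a pair_pre_digraph \<Rightarrow> nat" where
  "offensive_number G = Min (card ` {S. global_offensive_alliance G S})"

definition cartesian_product ::
    "'a pair_pre_digraph \<Rightarrow> 'b pair_pre_digraph \<Rightarrow> ('a \<times> 'b) pair_pre_digraph"
    (infixl "\<box>" 70) where
  "G \<box> H = \<lparr> pverts = pverts G \<times> pverts H,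
     parcs = {((a, b), (c, d)) | a b c d.
       a \<in> pverts G \<and> b \<in> pverts H \<and> c \<in> pverts G \<and> d \<in> pverts H \<and>
       (a = c \<and> (b, d) \<in> parcs H \<or> (a, c) \<in> parcs G \<and> b = d)} \<rparr>"

definition path_graph :: "nat \<Rightarrow> nat pair_pre_digraph" where
  "path_graph n = \<lparr> pverts = {..<n},
     parcs = {(i, j). i < n \<and> j < n \<and> (j = Suc i \<or> i = Suc j)} \<rparr>"

lemma pair_graphI:
  assumes "finite (pverts G)" "parcs G \<subseteq> pverts G \<times> pverts G" "sym (parcs G)"
    and "\<And>v. (v, v) \<notin> parcs G"
  shows "pair_graph G"
proof
  show "finite (parcs G)"
    using assms(1,2) by (meson finite_SigmaI finite_subset)
  show "symmetric (with_proj G)"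
    using assms(3) by (simp add: symmetric_def)
qed (use assms in auto)

lemma pair_graph_path_graph: "pair_graph (path_graph n)"
  by (rule pair_graphI) (auto simp: path_graph_def sym_def)

lemma pair_graph_cartesian_product:
  assumes "pair_graph G" "pair_graph H"
  shows "pair_graph (G \<box> H)"
proof -
  interpret G: pair_graph G by fact
  interpret H: pair_graph H by fact
  show ?thesis
    by (rule pair_graphI)
       (auto simp: cartesian_product_def sym_def G.arcs_symmetric H.arcs_symmetric
             dest: G.no_loops' H.no_loops')
qed

lemma global_offensive_alliance_pverts:
  "pverts G \<noteq> {} \<Longrightarrow> global_offensive_alliance G (pverts G)"
  by (simp add: global_offensive_alliance_def)

end

theory Submission
  imports Defs
begin

text \<open>
  Let \<open>S\<close> be a global offensive alliance of \<open>G \<box> path_graph n\<close> with layers \<open>S\<^sub>i\<close>.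
  If \<open>v\<close> lies in neither \<open>S\<^sub>i\<close> nor \<open>S\<^sub>i\<^sub>+\<^sub>1\<close>, then the path neighbours of \<open>(v, i)\<close> contribute at
  least as much outside \<open>S\<close> as inside, so the alliance condition at \<open>(v, i)\<close> is inherited by \<open>S\<^sub>i\<close>
  in \<open>G\<close>; hence \<open>S\<^sub>i \<union> S\<^sub>i\<^sub>+\<^sub>1\<close> is a global offensive alliance of \<open>G\<close>.  An end layer has only one path
  neighbour, so a vertex outside it has at least half of its \<open>G\<close>-neighbours inside, which gives
  at least \<open>\<lceil>\<delta>/2\<rceil>\<close> elements in each end layer.  Summing the sizes of consecutive layers counts
  every layer twice except the two end layers.
\<close>

definition layer :: "('a \<times> 'b) set \<Rightarrow> 'b \<Rightarrow> 'a set" where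
  "layer S b = {x. (x, b) \<in> S}"

definition fibre :: "('a \<times> 'b) set \<Rightarrow> 'a \<Rightarrow> 'b set" where
  "fibre S a = {y. (a, y) \<in> S}"

lemma finite_neighbours:
  assumes "pair_graph G"
  shows "finite (neighbours G v)"
proof -
  interpret pair_graph G by fact
  have "neighbours G v \<subseteq> pverts G"
    by (auto simp: neighbours_def dest: in_arcsD2)
  then show ?thesis
    using finite_subset pair_finite_verts by blast
qed

lemma degree_in_le_card: "finite S \<Longrightarrow> degree_in G S v \<le> card S"
  by (simp add: degree_in_def card_mono)

lemma degree_in_mono:
  assumes "pair_graph G" "S \<subseteq> T"
  shows "degree_in G S v \<le> degree_in G T v"
  using assms by (auto simp: degree_in_def finite_neighbours intro!: card_mono)

lemma degree_in_complement:
  assumes "pair_graph G"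
  shows "degree_in G S v + degree_in G (pverts G - S) v = card (neighbours G v)"
proof -
  interpret pair_graph G by fact
  have "neighbours G v \<inter> (pverts G - S) = neighbours G v - S"
    by (auto simp: neighbours_def dest: in_arcsD2)
  then show ?thesis
    using finite_neighbours[OF assms, of v]
    by (simp add: degree_in_def card_Int_Diff[of "neighbours G v" S])
qed

lemma min_degree_le_card_neighbours:
  assumes "pair_graph G" "v \<in> pverts G"
  shows "min_degree G \<le> card (neighbours G v)"
proof -
  interpret pair_graph G by fact
  show ?thesis
    using assms(2) by (simp add: min_degree_def)
qed

lemma finite_alliances:
  assumes "pair_graph G"
  shows "finite {S. global_offensive_alliance G S}"
proof -
  interpret pair_graph G by fact
  show ?thesis
    by (rule finite_subset[of _ "Pow (pverts G)"]) (auto simp: global_offensive_alliance_def)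
qed

lemma offensive_number_le_card:
  assumes "pair_graph G" "global_offensive_alliance G S"
  shows "offensive_number G \<le> card S"
  using assms finite_alliances[OF assms(1)] by (auto simp: offensive_number_def intro!: Min_le)

lemma ex_alliance_card_eq_offensive_number:
  assumes "pair_graph G" "pverts G \<noteq> {}"
  obtains S where "global_offensive_alliance G S" "card S = offensive_number G"
proof -
  have "offensive_number G \<in> card ` {S. global_offensive_alliance G S}"
    unfolding offensive_number_def
    using finite_alliances[OF assms(1)] global_offensive_alliance_pverts[OF assms(2)]
    by (intro Min_in) auto
  then show thesis
    using that by auto
qed

text \<open>Neighbours of \<open>(a, b)\<close> keep one coordinate and move the other; as
  \<open>G\<close> has no loops, no neighbour is of both kinds, so the two counts add up.\<close>

lemma degree_in_cartesian_product:
  assumes "pair_graph G" "pair_graph H" "a \<in> pverts G" "b \<in> pverts H"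
  shows "degree_in (G \<box> H) S (a, b) = degree_in G (layer S b) a + degree_in H (fibre S a) b"
proof -
  interpret G: pair_graph G by fact
  interpret H: pair_graph H by fact
  let ?X = "(\<lambda>x. (x, b)) ` (neighbours G a \<inter> layer S b)"
  let ?Y = "Pair a ` (neighbours H b \<inter> fibre S a)"
  have "neighbours (G \<box> H) (a, b) \<inter> S = ?X \<union> ?Y"
    using assms(3,4)
    by (auto simp: neighbours_def cartesian_product_def layer_def fibre_def
        dest: G.in_arcsD2 H.in_arcsD2)
  moreover have "?X \<inter> ?Y = {}"
    using G.no_loops' by (fastforce simp: neighbours_def)
  moreover have "finite ?X" "finite ?Y"
    using finite_neighbours[OF assms(1)] finite_neighbours[OF assms(2)] by auto
  ultimately show ?thesis
    by (simp add: degree_in_def card_Un_disjoint card_image inj_on_def)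
qed

text \<open>Complementation commutes with taking layers and fibres, so the degree splitting applies
  to \<open>S\<close> and to its complement alike.\<close>

lemma alliance_cartesian_product_layer:
  assumes "pair_graph G" "pair_graph H" "global_offensive_alliance (G \<box> H) S"
    and "a \<in> pverts G" "b \<in> pverts H" "a \<notin> layer S b"
  shows "degree_in G (pverts G - layer S b) a + degree_in H (pverts H - fibre S a) b + 1
    \<le> degree_in G (layer S b) a + degree_in H (fibre S a) b"
proof -
  have "layer (pverts (G \<box> H) - S) b = pverts G - layer S b"
    "fibre (pverts (G \<box> H) - S) a = pverts H - fibre S a"
    using assms(4,5) by (auto simp: layer_def fibre_def cartesian_product_def)
  moreover have "(a, b) \<in> pverts (G \<box> H) - S"
    using assms(4-6) by (auto simp: layer_def cartesian_product_def)
  ultimately show ?thesis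
    using assms(3) unfolding global_offensive_alliance_def
    by (metis degree_in_cartesian_product[OF assms(1,2,4,5)])
qed

lemma layer_subset_pverts:
  assumes "global_offensive_alliance (G \<box> H) S"
  shows "layer S b \<subseteq> pverts G"
  using assms by (auto simp: global_offensive_alliance_def layer_def cartesian_product_def)

lemma min_degree_le_two_card_layer:
  assumes "pair_graph G" "pair_graph H" "global_offensive_alliance (G \<box> H) S"
    and "pverts G \<noteq> {}" "b \<in> pverts H" "card (neighbours H b) \<le> 1"
  shows "min_degree G \<le> 2 * card (layer S b)"
proof -
  interpret G: pair_graph G by fact
  have fin: "finite (layer S b)"
    using layer_subset_pverts[OF assms(3)] finite_subset G.pair_finite_verts by blast
  have le: "degree_in G (layer S b) v \<le> card (layer S b)" for v
    using degree_in_le_card[OF fin] .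
  show ?thesis
  proof (cases "pverts G \<subseteq> layer S b")
    \<comment> \<open>No vertex outside the layer is available here, but every neighbour of any
      \<open>v\<close> lies in the layer, which gives even the bound without the factor 2.\<close>
    case True
    then have empty: "pverts G - layer S b = {}"
      by simp
    obtain v where "v \<in> pverts G"
      using assms(4) by auto
    then show ?thesis
      using min_degree_le_card_neighbours[OF assms(1), of v] le[of v]
        degree_in_complement[OF assms(1), of "layer S b" v] empty
      by (simp add: degree_in_def)
  next
    case False
    then obtain v where v: "v \<in> pverts G" "v \<notin> layer S b"
      by auto
    \<comment> \<open>The fibre contributes at most 1 inside \<open>S\<close>, which the
      \<open>+ 1\<close> of the alliance condition absorbs: at least half of the neighbours of
      \<open>v\<close> lie in the layer.\<close>
    show ?thesis
      using min_degree_le_card_neighbours[OF assms(1) v(1)] le[of v] assms(6)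
        alliance_cartesian_product_layer[OF assms(1-3) v(1) assms(5) v(2)]
        degree_in_complement[OF assms(1), of "layer S b" v]
        degree_in_complement[OF assms(2), of "fibre S v" b]
      by linarith
  qed
qed

lemma alliance_adjacent_layers_Un:
  assumes "pair_graph G" "pair_graph H" "global_offensive_alliance (G \<box> H) S"
    and "pverts G \<noteq> {}" "(b, c) \<in> parcs H" "card (neighbours H b) \<le> 2"
  shows "global_offensive_alliance G (layer S b \<union> layer S c)"
proof -
  interpret H: pair_graph H by fact
  let ?U = "layer S b \<union> layer S c"
  have b: "b \<in> pverts H" "c \<in> pverts H"
    using assms(5) by (auto dest: H.wellformed')
  have dom: "degree_in G ?U v \<ge> degree_in G (pverts G - ?U) v + 1"
    if v: "v \<in> pverts G" "v \<notin> ?U" for v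
  proof -
    \<comment> \<open>With \<open>c\<close> outside the fibre, at most one of the at most two
      neighbours of \<open>b\<close> is inside, so the fibre terms cannot help the inequality at
      \<open>(v, b)\<close>.\<close>
    have "c \<in> neighbours H b \<inter> (pverts H - fibre S v)"
      using v b assms(5) by (auto simp: neighbours_def fibre_def layer_def)
    then have "degree_in H (pverts H - fibre S v) b \<ge> 1"
      using finite_neighbours[OF assms(2)]
      by (auto simp: degree_in_def Suc_le_eq card_gt_0_iff)
    then have "degree_in G (pverts G - layer S b) v + 1 \<le> degree_in G (layer S b) v"
      using alliance_cartesian_product_layer[OF assms(1-3) v(1) b(1)] v(2) assms(6)
        degree_in_complement[OF assms(2), of "fibre S v" b]
      by auto
    moreover have "degree_in G (layer S b) v \<le> degree_in G ?U v"
      "degree_in G (pverts G - ?U) v \<le> degree_in G (pverts G - layer S b) v"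
      by (auto intro!: degree_in_mono[OF assms(1)])
    ultimately show ?thesis
      by linarith
  qed
  \<comment> \<open>An empty union would make \<open>dom\<close> demand a positive degree into the
    empty set at any vertex of \<open>G\<close>.\<close>
  moreover have "?U \<noteq> {}"
    using dom assms(4) by (force simp: degree_in_def)
  ultimately show ?thesis
    using layer_subset_pverts[OF assms(3)] by (auto simp: global_offensive_alliance_def)
qed

lemma card_neighbours_path_graph_le: "card (neighbours (path_graph n) i) \<le> 2"
proof -
  have "card (neighbours (path_graph n) i) \<le> card {i - 1, Suc i}"
    by (intro card_mono) (auto simp: neighbours_def path_graph_def)
  then show ?thesis
    by (simp split: if_splits)
qed

lemma card_neighbours_path_graph_end:
  assumes "i = 0 \<or> i = n - 1"
  shows "card (neighbours (path_graph n) i) \<le> 1"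
proof -
  \<comment> \<open>Only an inclusion: for \<open>n = 1\<close> the single vertex has no
    neighbour.\<close>
  have "neighbours (path_graph n) i \<subseteq> {if i = 0 then 1 else i - 1}"
    using assms by (auto simp: neighbours_def path_graph_def)
  from card_mono[OF _ this] show ?thesis
    by simp
qed

lemma card_eq_sum_card_layer:
  assumes "finite S" "finite B" "S \<subseteq> A \<times> B"
  shows "card S = (\<Sum>b\<in>B. card (layer S b))"
proof -
  \<comment> \<open>The swap makes the second coordinate the index of the dependent sum.\<close>
  have "S = prod.swap ` (SIGMA b:B. layer S b)"
    using assms(3) by (force simp: layer_def)
  then have "card S = card (SIGMA b:B. layer S b)"
    by (metis card_image inj_on_subset inj_swap subset_UNIV)
  moreover have "finite (layer S b)" for b
    using finite_subset[of "layer S b" "fst ` S"] assms(1) by (force simp: layer_def)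
  ultimately show ?thesis
    using assms(2) by simp
qed

lemma sum_consecutive:
  fixes f :: "nat \<Rightarrow> nat"
  shows "(\<Sum>i<m. f i + f (Suc i)) + f 0 + f m = 2 * (\<Sum>i<Suc m. f i)"
  by (induction m) auto

theorem theorem5:
  fixes G :: "'a pair_pre_digraph" and n :: nat
  assumes "pair_graph G" and "pverts G \<noteq> {}"
    and "min_degree G \<ge> 1"
    and "n \<ge> 1"
  shows "int (offensive_number (G \<box> path_graph n))
           \<ge> \<lceil>(real n - 1) * real (offensive_number G) / 2\<rceil> + \<lceil>real (min_degree G) / 2\<rceil>"
proof -
  let ?P = "path_graph n"
  note P = pair_graph_path_graph[of n]
  have GP: "pair_graph (G \<box> ?P)"
    by (rule pair_graph_cartesian_product[OF assms(1) P])
  \<comment> \<open>The layers are then \<open>0\<close> to \<open>m\<close>, with \<open>m\<close>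
    consecutive pairs; for \<open>m = 0\<close> the two end layers coincide and the counting still
    holds.\<close>
  obtain m where n: "n = Suc m"
    using assms(4) by (cases n) auto
  have "pverts (G \<box> ?P) \<noteq> {}"
    using assms(2) n by (auto simp: cartesian_product_def path_graph_def)
  then obtain S where S: "global_offensive_alliance (G \<box> ?P) S"
    and card_S: "card S = offensive_number (G \<box> ?P)"
    using ex_alliance_card_eq_offensive_number[OF GP] by metis
  interpret GP: pair_graph "G \<box> ?P" by (rule GP)
  define s where "s i = card (layer S i)" for i
  have sub: "S \<subseteq> pverts (G \<box> ?P)"
    using S by (simp add: global_offensive_alliance_def)
  then have "finite S"
    using finite_subset GP.pair_finite_verts by blast
  then have sum: "card S = (\<Sum>i<Suc m. s i)"
    using card_eq_sum_card_layer[of S "{..<n}" "pverts G"] sub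
    by (simp add: s_def n cartesian_product_def path_graph_def)
  have pair: "offensive_number G \<le> s i + s (Suc i)" if "i < m" for i
  proof -
    have "(i, Suc i) \<in> parcs ?P"
      using that n by (simp add: path_graph_def)
    then have "offensive_number G \<le> card (layer S i \<union> layer S (Suc i))"
      by (intro offensive_number_le_card alliance_adjacent_layers_Un[OF assms(1) P S assms(2)]
          card_neighbours_path_graph_le assms(1))
    then show ?thesis
      unfolding s_def using card_Un_le le_trans by blast
  qed
  have ends: "min_degree G \<le> 2 * s i" if "i = 0 \<or> i = m" for i
    unfolding s_def using that n
    by (intro min_degree_le_two_card_layer[OF assms(1) P S assms(2)]
        card_neighbours_path_graph_end) (auto simp: path_graph_def)
  define d where "d = \<lceil>real (min_degree G) / 2\<rceil>"
  \<comment> \<open>Rounding up is free because layer sizes are integers.\<close>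
  have "d \<le> int (s 0)" "d \<le> int (s m)"
    using ends[of 0] ends[of m] by (auto simp: d_def ceiling_le_iff)
  moreover define k where "k = m * offensive_number G"
  have "k \<le> (\<Sum>i<m. s i + s (Suc i))"
    using sum_mono[of "{..<m}" "\<lambda>_. offensive_number G" "\<lambda>i. s i + s (Suc i)"] pair
    by (simp add: k_def)
  then have "k + s 0 + s m \<le> 2 * card S"
    using sum_consecutive[of s m] sum by linarith
  \<comment> \<open>Since \<open>d\<close> is already an integer, halving and rounding up now
    affects \<open>k\<close> alone, giving a sum of two ceilings.\<close>
  ultimately have "int k \<le> 2 * (int (card S) - d)"
    by presburger
  then have "real_of_int (int k) \<le> real_of_int (2 * (int (card S) - d))"
    by (simp only: of_int_le_iff)
  then have "\<lceil>(real n - 1) * real (offensive_number G) / 2\<rceil> \<le> int (card S) - d"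
    by (simp add: ceiling_le_iff n k_def)
  then show ?thesis
    using card_S by (simp add: d_def)
qed

end
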